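(* Let $p,m$ be positive integers. On the set $\mathbb{S}(H^\infty,p,m)$ of stabilizable plants, the metrics $d_\nu$ and $\widetilde d_\nu$ defined in the context coincide: for all $P_1,P_2\in\mathbb{S}(H^\infty,p,m)$, $$d_\nu(P_1,P_2)=\widetilde d_\nu(P_1,P_2).$$
   Context: **The algebra $S$.** $\mathbb{D}=\{|z|<1\}$, $\mathbb{T}=\{|z|=1\}$; $H^\infty$ is the algebra of bounded holomorphic functions on $\mathbb{D}$. For $r\in(0,1)$ let $\mathbb{A}_r:=\{z\in\mathbb{C}: r<|z|<1\}$ and let $C_b(\mathbb{A}_r)$ be the $C^*$-algebra of bounded continuous functions $f:\mathbb{A}_r\to\mathbb{C}$ with pointwise operations, supremum norm $\|\cdot\|_{L^\infty(\mathbb{A}_r)}$ and involution $f^*(z)=\overline{f(z)}$. Let $\mathcal{A}$ be the $*$-subalgebra of $\prod_{r\in(0,1)}C_b(\mathbb{A}_r)$ of all $(f_r)$ for which there is $r_0\in(0,1)$ with $f_r|_{\mathbb{A}_R}=f_R$ for all $r_0\le r\le R<1$. Put $\|(f_r)\|:=\lim_{r\to1}\|f_r\|_{L^\infty(\mathbb{A}_r)}$, a seminorm with kernel $N$; the $C^*$-algebra $S:=\mathcal{A}/N$ is denoted $\varinjlim C_b(\mathbb{A}_r)$ and $[(f_r)]$ is the class of $(f_r)$. A bounded continuous function $f$ on $\{0<|z|<1\}$ (in particular an element of $H^\infty$) is viewed as the element $[(f|_{\mathbb{A}_r})_r]$ of $S$; on $H^\infty$ this is an embedding. $\operatorname{inv}$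 denotes the set of invertible elements of an algebra. **Index.** $w(h)\in\mathbb{Z}$ is the winding number around $0$ of a nowhere vanishing $h\in C(\mathbb{T})$; for a nowhere vanishing continuous $g$ on $\mathbb{T}_\rho=\{|z|=\rho\}$, $w(g|_{\mathbb{T}_\rho})$ is the winding number of $\zeta\mapsto g(\rho\zeta)$. For $f=[(f_r)]\in\operatorname{inv}S$, $W(f):=\lim_{r\to1}w(f_r|_{\mathbb{T}_\rho})$, $\rho\in(r,1)$ (this is well defined). **Plants.** $\mathbb{F}(H^\infty)$ is the field of fractions of $H^\infty$. For a matrix $F$ with entries in $S$, $F^*$ is given by $(F^* )_{ij}=(F_{ji})^*$. For $P\in\mathbb{F}(H^\infty)^{p\times m}$, a factorization $P=ND^{-1}$ with $N,D$ matrices over $H^\infty$ is a normalized right coprime factorization if there exist matrices $X,Y$ over $H^\infty$ with $XN+YD=I_m$, and $N^*N+D^*D=I_m$ (in $S$). A factorization $P=\widetilde D^{-1}\widetilde N$ with $\widetilde D,\widetilde N$ over $H^\infty$ is a normalized left coprime factorization if there exist $\widetilde X,\widetilde Y$ over $H^\infty$ with $\widetilde N\widetilde X+\widetilde D\widetilde Y=I_p$, and $\widetilde N\widetilde N^*+\widetilde D\widetilde D^*=I_p$ (in $S$). $\mathbb{S}(H^\infty,p,m)$ is the set of $P\in\mathbb{F}(H^\infty)^{p\times m}$ possessing both a normalized right and a normalized left coprime factorization. **The two metrics.** For $P_1,P_2\in\mathbb{S}(H^\infty,p,m)$ with normalized coprime factorizations $P_i=N_iD_i^{-1}=\widetilde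 D_i^{-1}\widetilde N_i$ ($i=1,2$), put $$G_i:=\begin{bmatrix}N_i\\ D_i\end{bmatrix},\qquad \widetilde G_i:=\begin{bmatrix}-\widetilde D_i&\widetilde N_i\end{bmatrix}.$$ For a matrix $F$ over $H^\infty$, $\|F\|_\infty=\sup_{z\in\mathbb{D}}|F(z)|$ with $|\cdot|$ the operator norm induced by Euclidean norms. The function $\det(G_1^*G_2)$ is the bounded continuous function $z\mapsto\det(G_1(z)^*G_2(z))$, considered as an element of $S$ or, by restriction, of $C_b(\mathbb{A}_\rho)$. Definition of $d_\nu$: $d_\nu(P_1,P_2)=\|\widetilde G_2G_1\|_\infty$ if $\det(G_1^*G_2)\in\operatorname{inv}S$ and $W(\det(G_1^*G_2))=0$; otherwise $d_\nu(P_1,P_2)=1$. Definition of $\widetilde d_\nu$: for $\rho\in(0,1)$, $\widetilde d_\nu^{\,\rho}(P_1,P_2)=\|\widetilde G_2G_1\|_\infty$ if $\det(G_1^*G_2)\in\operatorname{inv}C_b(\mathbb{A}_\rho)$ and $w(\det(G_1^*G_2)|_{\mathbb{T}_r})=0$ for $r\in(\rho,1)$; otherwise $\widetilde d_\nu^{\,\rho}(P_1,P_2)=1$. Then $\widetilde d_\nu(P_1,P_2):=\lim_{\rho\to1}\widetilde d_\nu^{\,\rho}(P_1,P_2)$. Both quantities are computed with the same choice of normalized factorizations (they are known not to depend on this choice). *)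

theory Defs
  imports "HOL-Complex_Analysis.Complex_Analysis" "HOL-Computational_Algebra.Fraction_Field"
begin

section \<open>The algebra of bounded holomorphic functions on the unit disc\<close>

text \<open>Functions are set to 0 off the disc, so that equality in the type is equality on the disc.\<close>

typedef hinf =
  "{f :: complex \<Rightarrow> complex. f holomorphic_on ball 0 1 \<and> bounded (f ` ball 0 1) \<and>
     (\<forall>z. z \<notin> ball 0 1 \<longrightarrow> f z = 0)}"
  by (rule exI[of _ "\<lambda>_. 0"]) (auto simp: bounded_iff)

setup_lifting type_definition_hinf

lemma bounded_image_add:
  fixes f g :: "'a \<Rightarrow> complex"
  assumes "bounded (f ` A)" "bounded (g ` A)"
  shows "bounded ((\<lambda>z. f z + g z) ` A)"
proof -
  from assms obtain a b where "\<forall>z\<in>A. norm (f z) \<le> a" "\<forall>z\<in>A. norm (g z) \<le> b"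
    by (auto simp: bounded_iff)
  then have "\<forall>z\<in>A. norm (f z + g z) \<le> a + b" by (meson add_mono norm_triangle_ineq order_trans)
  then show ?thesis by (auto simp: bounded_iff)
qed

lemma bounded_image_mult:
  fixes f g :: "'a \<Rightarrow> complex"
  assumes "bounded (f ` A)" "bounded (g ` A)"
  shows "bounded ((\<lambda>z. f z * g z) ` A)"
proof -
  from assms obtain a b where ab: "\<forall>z\<in>A. norm (f z) \<le> a" "\<forall>z\<in>A. norm (g z) \<le> b"
    by (auto simp: bounded_iff)
  have "\<forall>z\<in>A. norm (f z * g z) \<le> a * b"
  proof
    fix z assume "z \<in> A"
    then have "norm (f z) \<le> a" "norm (g z) \<le> b" using ab by auto
    then show "norm (f z * g z) \<le> a * b"
      unfolding norm_mult by (intro mult_mono') auto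
  qed
  then show ?thesis by (auto simp: bounded_iff)
qed

lemma bounded_image_uminus:
  fixes f :: "'a \<Rightarrow> complex"
  shows "bounded (f ` A) \<Longrightarrow> bounded ((\<lambda>z. - f z) ` A)"
  by (auto simp: bounded_iff)

lemma bounded_image_cnj:
  fixes f :: "'a \<Rightarrow> complex"
  shows "bounded (f ` A) \<Longrightarrow> bounded ((\<lambda>z. cnj (f z)) ` A)"
  by (auto simp: bounded_iff)

instantiation hinf :: comm_ring_1
begin

lift_definition zero_hinf :: hinf is "\<lambda>_. 0"
  by (auto simp: bounded_iff)
lift_definition one_hinf :: hinf is "\<lambda>z. if z \<in> ball 0 1 then 1 else 0"
proof -
  have "(\<lambda>z. if z \<in> ball 0 1 then 1 else 0 :: complex) holomorphic_on ball 0 1"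
    by (rule holomorphic_transform[OF holomorphic_on_const[of 1]]) auto
  then show ?thesis by (auto simp: bounded_iff)
qed
lift_definition plus_hinf :: "hinf \<Rightarrow> hinf \<Rightarrow> hinf" is "\<lambda>f g z. f z + g z"
  by (auto intro: bounded_image_add holomorphic_on_add)
lift_definition times_hinf :: "hinf \<Rightarrow> hinf \<Rightarrow> hinf" is "\<lambda>f g z. f z * g z"
  by (auto intro: bounded_image_mult holomorphic_on_mult)
lift_definition uminus_hinf :: "hinf \<Rightarrow> hinf" is "\<lambda>f z. - f z"
  by (auto intro: bounded_image_uminus holomorphic_on_minus)
definition minus_hinf :: "hinf \<Rightarrow> hinf \<Rightarrow> hinf" where "minus_hinf f g = f + - g"

instance
proof
  fix a b c :: hinf
  show "a * b * c = a * (b * c)" by transfer (auto simp: mult.assoc)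
  show "a * b = b * a" by transfer (auto simp: mult.commute)
  show "1 * a = a" by transfer auto
  show "a + b + c = a + (b + c)" by transfer (auto simp: add.assoc)
  show "a + b = b + a" by transfer (auto simp: add.commute)
  show "0 + a = a" by transfer auto
  show "- a + a = 0" by transfer auto
  show "a - b = a + - b" by (rule minus_hinf_def)
  show "(a + b) * c = a * c + b * c" by transfer (auto simp: distrib_right)
  show "(0::hinf) \<noteq> 1"
    by transfer (metis centre_in_ball zero_less_one zero_neq_one)
qed

end

instance hinf :: idom
proof
  fix a b :: hinf
  assume "a \<noteq> 0" "b \<noteq> 0"
  then show "a * b \<noteq> 0"
  proof transfer
    fix f g :: "complex \<Rightarrow> complex"
    assume f: "f holomorphic_on ball 0 1 \<and> bounded (f ` ball 0 1) \<and> (\<forall>z. z \<notin> ball 0 1 \<longrightarrow> f z = 0)"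
      and g: "g holomorphic_on ball 0 1 \<and> bounded (g ` ball 0 1) \<and> (\<forall>z. z \<notin> ball 0 1 \<longrightarrow> g z = 0)"
      and f0: "f \<noteq> (\<lambda>_. 0)" and g0: "g \<noteq> (\<lambda>_. 0)"
    from f0 obtain w where fw: "f w \<noteq> 0" by auto
    with f have w: "w \<in> ball 0 1" by blast
    show "(\<lambda>z. f z * g z) \<noteq> (\<lambda>_. 0)"
    proof
      assume "(\<lambda>z. f z * g z) = (\<lambda>_. 0)"
      then have fg: "f z = 0 \<or> g z = 0" for z by (metis mult_eq_0_iff)
      have "isCont f w"
        using f w by (meson continuous_on_eq_continuous_at holomorphic_on_imp_continuous_on open_ball)
      then have "\<forall>\<^sub>F z in at w. f z \<noteq> 0"
        using fw by (simp add: isCont_def tendsto_imp_eventually_ne)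
      then have "\<forall>\<^sub>F z in nhds w. f z \<noteq> 0"
        using fw unfolding eventually_at_filter by (auto elim: eventually_mono)
      then obtain U where U: "open U" "w \<in> U" "\<forall>z\<in>U. f z \<noteq> 0"
        by (auto simp: eventually_nhds)
      have "g z = 0" if z: "z \<in> ball 0 1" for z
      proof (rule analytic_continuation_open[of "U \<inter> ball 0 1" "ball 0 1" g "\<lambda>_. 0"])
        show "U \<inter> ball 0 1 \<noteq> {}" using U w by blast
        show "g z = 0" if "z \<in> U \<inter> ball 0 1" for z using that U fg by blast
      qed (use U g z in auto)
      then have "g = (\<lambda>_. 0)" using g by blast
      with g0 show False by blast
    qed
  qed
qed


section \<open>The algebra S\<close>

definition annulus :: "real \<Rightarrow> complex set" where
  "annulus r = {z. r < cmod z \<and> cmod z < 1}"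

text \<open>A function on an annulus is represented by a total function whose values off the annulus
  are irrelevant.\<close>

definition Cb :: "real \<Rightarrow> (complex \<Rightarrow> complex) set" where
  "Cb r = {f. continuous_on (annulus r) f \<and> bounded (f ` annulus r)}"

definition Cb_inv :: "real \<Rightarrow> (complex \<Rightarrow> complex) set" where
  "Cb_inv r = {f \<in> Cb r. \<exists>g \<in> Cb r. \<forall>z \<in> annulus r. f z * g z = 1}"

definition sup_norm :: "real \<Rightarrow> (complex \<Rightarrow> complex) \<Rightarrow> real" where
  "sup_norm r f = (SUP z \<in> annulus r. cmod (f z))"

definition families :: "(real \<Rightarrow> complex \<Rightarrow> complex) set" where
  "families = {F. (\<forall>r \<in> {0<..<1}. F r \<in> Cb r) \<and>
     (\<exists>r0 \<in> {0<..<1}. \<forall>r R. r0 \<le> r \<longrightarrow> r \<le> R \<longrightarrow> R < 1 \<longrightarrow> (\<forall>z \<in> annulus R. F r z = F R z))}"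

definition seminorm :: "(real \<Rightarrow> complex \<Rightarrow> complex) \<Rightarrow> real" where
  "seminorm F = Lim (at_left 1) (\<lambda>r. sup_norm r (F r))"

definition null_families :: "(real \<Rightarrow> complex \<Rightarrow> complex) set" where
  "null_families = {F \<in> families. seminorm F = 0}"

definition fam_rel :: "(real \<Rightarrow> complex \<Rightarrow> complex) \<Rightarrow> (real \<Rightarrow> complex \<Rightarrow> complex) \<Rightarrow> bool" where
  "fam_rel F G \<longleftrightarrow> F \<in> families \<and> G \<in> families \<and> (\<lambda>r z. F r z - G r z) \<in> null_families"

lemma annulus_nonempty: "0 < r \<Longrightarrow> r < 1 \<Longrightarrow> annulus r \<noteq> {}"
  using dense[of r 1] unfolding annulus_def
  by (metis (mono_tags, lifting) abs_of_pos empty_iff mem_Collect_eq norm_of_real order_less_trans)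

lemma annulus_mono: "r \<le> R \<Longrightarrow> annulus R \<subseteq> annulus r"
  by (auto simp: annulus_def)

lemma Cb_bdd: "f \<in> Cb r \<Longrightarrow> bdd_above ((\<lambda>z. cmod (f z)) ` annulus r)"
  by (auto simp: Cb_def bounded_iff bdd_above_def)

lemma Cb_add: "f \<in> Cb r \<Longrightarrow> g \<in> Cb r \<Longrightarrow> (\<lambda>z. f z + g z) \<in> Cb r"
  by (auto simp: Cb_def intro: continuous_intros bounded_image_add)

lemma Cb_mult: "f \<in> Cb r \<Longrightarrow> g \<in> Cb r \<Longrightarrow> (\<lambda>z. f z * g z) \<in> Cb r"
  by (auto simp: Cb_def intro: continuous_intros bounded_image_mult)

lemma Cb_uminus: "f \<in> Cb r \<Longrightarrow> (\<lambda>z. - f z) \<in> Cb r"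
  by (auto simp: Cb_def intro: continuous_intros bounded_image_uminus)

lemma Cb_cnj: "f \<in> Cb r \<Longrightarrow> (\<lambda>z. cnj (f z)) \<in> Cb r"
  by (auto simp: Cb_def intro: continuous_intros bounded_image_cnj)

lemma families_const: "(\<lambda>_ _. c) \<in> families"
proof -
  have "(\<lambda>_. c) \<in> Cb r" for r by (auto simp: Cb_def bounded_iff)
  moreover have "(1/2 :: real) \<in> {0<..<1}" by simp
  ultimately show ?thesis unfolding families_def by blast
qed

lemma families_binary:
  assumes F: "F \<in> families" and G: "G \<in> families"
    and op: "\<And>r f g. f \<in> Cb r \<Longrightarrow> g \<in> Cb r \<Longrightarrow> (\<lambda>z. h (f z) (g z)) \<in> Cb r"
  shows "(\<lambda>r z. h (F r z) (G r z)) \<in> families"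
proof -
  from F obtain a where a: "a \<in> {0<..<1}"
    "\<And>r R z. a \<le> r \<Longrightarrow> r \<le> R \<Longrightarrow> R < 1 \<Longrightarrow> z \<in> annulus R \<Longrightarrow> F r z = F R z"
    unfolding families_def by blast
  from G obtain b where b: "b \<in> {0<..<1}"
    "\<And>r R z. b \<le> r \<Longrightarrow> r \<le> R \<Longrightarrow> R < 1 \<Longrightarrow> z \<in> annulus R \<Longrightarrow> G r z = G R z"
    unfolding families_def by blast
  have "max a b \<in> {0<..<1}" using a(1) b(1) by auto
  moreover have "h (F r z) (G r z) = h (F R z) (G R z)"
    if "max a b \<le> r" "r \<le> R" "R < 1" "z \<in> annulus R" for r R z
    using that a(2)[of r R z] b(2)[of r R z] by auto
  ultimately show ?thesis using F G op unfolding families_def by blast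
qed

lemma families_unary:
  assumes F: "F \<in> families" and op: "\<And>r f. f \<in> Cb r \<Longrightarrow> (\<lambda>z. h (f z)) \<in> Cb r"
  shows "(\<lambda>r z. h (F r z)) \<in> families"
  using families_binary[OF F F, of "\<lambda>x _. h x"] op by blast

lemma families_add:
  "F \<in> families \<Longrightarrow> G \<in> families \<Longrightarrow> (\<lambda>r z. F r z + G r z) \<in> families"
  using families_binary[of F G "(+)"] Cb_add by blast

lemma families_mult:
  "F \<in> families \<Longrightarrow> G \<in> families \<Longrightarrow> (\<lambda>r z. F r z * G r z) \<in> families"
  using families_binary[of F G "(*)"] Cb_mult by blast

lemma families_uminus: "F \<in> families \<Longrightarrow> (\<lambda>r z. - F r z) \<in> families"
  using families_unary[of F uminus] Cb_uminus by blast

lemma families_cnj: "F \<in> families \<Longrightarrow> (\<lambda>r z. cnj (F r z)) \<in> families"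
  using families_unary[of F cnj] Cb_cnj by blast

lemma families_diff:
  "F \<in> families \<Longrightarrow> G \<in> families \<Longrightarrow> (\<lambda>r z. F r z - G r z) \<in> families"
  using families_add[OF _ families_uminus, of F G] by simp

lemma eventually_left_1:
  fixes P :: "real \<Rightarrow> bool"
  shows "eventually P (at_left 1) \<longleftrightarrow> (\<exists>b \<in> {0<..<1}. \<forall>r. b < r \<longrightarrow> r < 1 \<longrightarrow> P r)"
proof -
  have "eventually P (at_left 1) \<longleftrightarrow> (\<exists>b<1. \<forall>r. b < r \<longrightarrow> r < 1 \<longrightarrow> P r)"
    by (rule eventually_at_left_field)
  also have "\<dots> \<longleftrightarrow> (\<exists>b \<in> {0<..<1}. \<forall>r. b < r \<longrightarrow> r < 1 \<longrightarrow> P r)"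
  proof
    assume "\<exists>b<1. \<forall>r. b < r \<longrightarrow> r < 1 \<longrightarrow> P r"
    then obtain b where "b < 1" "\<forall>r. b < r \<longrightarrow> r < 1 \<longrightarrow> P r" by blast
    then show "\<exists>b \<in> {0<..<1}. \<forall>r. b < r \<longrightarrow> r < 1 \<longrightarrow> P r"
      by (intro bexI[of _ "max b (1/2)"]) auto
  qed auto
  finally show ?thesis .
qed

text \<open>The limit in the definition of the seminorm exists.\<close>

lemma seminorm_tendsto:
  assumes F: "F \<in> families"
  shows "((\<lambda>r. sup_norm r (F r)) \<longlongrightarrow> seminorm F) (at_left 1)"
proof -
  from F obtain a where a: "a \<in> {0<..<1}"
    "\<And>r R z. a \<le> r \<Longrightarrow> r \<le> R \<Longrightarrow> R < 1 \<Longrightarrow> z \<in> annulus R \<Longrightarrow> F r z = F R z"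
    unfolding families_def by blast
  let ?s = "\<lambda>r. sup_norm r (F r)"
  have anti: "?s R \<le> ?s r" if "a \<le> r" "r \<le> R" "R < 1" for r R
  proof -
    have "F r \<in> Cb r" using F that a(1) by (auto simp: families_def)
    then have bdd: "bdd_above ((\<lambda>z. cmod (F r z)) ` annulus r)" by (rule Cb_bdd)
    have "?s R = (SUP z \<in> annulus R. cmod (F r z))"
      unfolding sup_norm_def using a(2)[OF that] by (intro SUP_cong) auto
    also have "\<dots> \<le> ?s r"
      unfolding sup_norm_def using that a(1)
      by (intro cSUP_subset_mono annulus_nonempty bdd annulus_mono) auto
    finally show ?thesis .
  qed
  have nonneg: "0 \<le> ?s r" if r: "0 < r" "r < 1" for r
  proof -
    obtain z where z: "z \<in> annulus r" using annulus_nonempty r by blast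
    have "bdd_above ((\<lambda>z. cmod (F r z)) ` annulus r)"
      using F r by (intro Cb_bdd) (auto simp: families_def)
    then have "cmod (F r z) \<le> ?s r" unfolding sup_norm_def by (intro cSUP_upper z)
    then show ?thesis by (meson norm_ge_zero order_trans)
  qed
  define c where "c = (INF r \<in> {a<..<1}. ?s r)"
  have bdd: "bdd_below (?s ` {a<..<1})" using a(1) nonneg by (intro bdd_belowI2[of _ 0]) auto
  have "(?s \<longlongrightarrow> c) (at_left 1)"
  proof (rule order_tendstoI)
    fix y assume y: "y < c"
    have "y < ?s r" if "a < r" "r < 1" for r
      using cINF_lower[OF bdd, of r] that y unfolding c_def by auto
    then show "\<forall>\<^sub>F r in at_left 1. y < ?s r" using a(1) unfolding eventually_left_1 by blast
  next
    fix y assume y: "c < y"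
    have "{a<..<1} \<noteq> {}" using a(1) by auto
    then obtain b where b: "b \<in> {a<..<1}" "?s b < y"
      using y bdd unfolding c_def by (subst (asm) cINF_less_iff) auto
    have "?s r < y" if "b < r" "r < 1" for r using anti[of b r] that b by auto
    then show "\<forall>\<^sub>F r in at_left 1. ?s r < y" using a(1) b(1) unfolding eventually_left_1
      by (intro bexI[of _ b]) auto
  qed
  then show ?thesis unfolding seminorm_def by (simp add: tendsto_Lim)
qed

lemma null_families_iff:
  "F \<in> null_families \<longleftrightarrow> F \<in> families \<and>
     (\<forall>e>0. \<forall>\<^sub>F r in at_left 1. \<forall>z \<in> annulus r. cmod (F r z) \<le> e)" (is "_ \<longleftrightarrow> _ \<and> ?R")
proof (cases "F \<in> families")
  case True
  have ev: "\<forall>\<^sub>F r in at_left (1::real). 0 < r \<and> r < 1"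
    unfolding eventually_left_1 by (rule bexI[of _ "1/2"]) auto
  have bdd: "bdd_above ((\<lambda>z. cmod (F r z)) ` annulus r)" if "0 < r" "r < 1" for r
    using True that by (intro Cb_bdd) (auto simp: families_def)
  have "seminorm F = 0 \<longleftrightarrow> ?R"
  proof
    assume "seminorm F = 0"
    then have lim: "((\<lambda>r. sup_norm r (F r)) \<longlongrightarrow> 0) (at_left 1)"
      using seminorm_tendsto[OF True] by simp
    show ?R
    proof (intro allI impI)
      fix e :: real assume "0 < e"
      then have "\<forall>\<^sub>F r in at_left 1. sup_norm r (F r) < e" using lim by (rule order_tendstoD(2)[rotated])
      with ev show "\<forall>\<^sub>F r in at_left 1. \<forall>z \<in> annulus r. cmod (F r z) \<le> e"
      proof eventually_elim
        case (elim r)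
        show ?case
        proof
          fix z assume "z \<in> annulus r"
          then have "cmod (F r z) \<le> sup_norm r (F r)"
            unfolding sup_norm_def using bdd elim by (intro cSUP_upper) auto
          then show "cmod (F r z) \<le> e" using elim by simp
        qed
      qed
    qed
  next
    assume R: ?R
    have "\<bar>seminorm F\<bar> \<le> e" if "0 < e" for e
    proof (rule tendsto_upperbound)
      show "((\<lambda>r. \<bar>sup_norm r (F r)\<bar>) \<longlongrightarrow> \<bar>seminorm F\<bar>) (at_left 1)"
        by (intro tendsto_rabs seminorm_tendsto True)
      have "\<forall>\<^sub>F r in at_left 1. \<forall>z \<in> annulus r. cmod (F r z) \<le> e" using R that by blast
      with ev show "\<forall>\<^sub>F r in at_left 1. \<bar>sup_norm r (F r)\<bar> \<le> e"
      proof eventually_elim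
        case (elim r)
        have "sup_norm r (F r) \<le> e"
          unfolding sup_norm_def using elim by (intro cSUP_least annulus_nonempty) auto
        moreover obtain z where z: "z \<in> annulus r" using annulus_nonempty elim by blast
        have "cmod (F r z) \<le> sup_norm r (F r)"
          unfolding sup_norm_def using bdd elim z by (intro cSUP_upper) auto
        then have "0 \<le> sup_norm r (F r)" by (meson norm_ge_zero order_trans)
        ultimately show ?case by simp
      qed
    qed simp
    then show "seminorm F = 0" 
      using field_le_epsilon[of "\<bar>seminorm F\<bar>" 0] by simp
  qed
  then show ?thesis using True by (simp add: null_families_def)
qed (simp add: null_families_def)

lemma null_families_add:
  assumes "F \<in> null_families" "G \<in> null_families"
  shows "(\<lambda>r z. F r z + G r z) \<in> null_families"
  unfolding null_families_iff
proof (intro conjI allI impI)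
  show "(\<lambda>r z. F r z + G r z) \<in> families"
    using assms by (intro families_add) (auto simp: null_families_def)
  fix e :: real assume "0 < e"
  then have "0 < e / 2" by simp
  then have "\<forall>\<^sub>F r in at_left 1. \<forall>z \<in> annulus r. cmod (F r z) \<le> e / 2"
    and "\<forall>\<^sub>F r in at_left 1. \<forall>z \<in> annulus r. cmod (G r z) \<le> e / 2"
    using assms unfolding null_families_iff by blast+
  then show "\<forall>\<^sub>F r in at_left 1. \<forall>z \<in> annulus r. cmod (F r z + G r z) \<le> e"
  proof eventually_elim
    case (elim r)
    show ?case
    proof
      fix z assume "z \<in> annulus r"
      then have "cmod (F r z) \<le> e / 2" "cmod (G r z) \<le> e / 2" using elim by auto
      then show "cmod (F r z + G r z) \<le> e"
        using norm_triangle_ineq[of "F r z" "G r z"] by linarith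
    qed
  qed
qed

lemma families_eventually_bounded:
  assumes F: "F \<in> families"
  shows "\<exists>M>0. \<forall>\<^sub>F r in at_left 1. \<forall>z \<in> annulus r. cmod (F r z) \<le> M"
proof -
  from F obtain a where a: "a \<in> {0<..<1}"
    "\<And>r R z. a \<le> r \<Longrightarrow> r \<le> R \<Longrightarrow> R < 1 \<Longrightarrow> z \<in> annulus R \<Longrightarrow> F r z = F R z"
    unfolding families_def by blast
  have "F a \<in> Cb a" using F a(1) by (auto simp: families_def)
  then obtain M where M: "\<forall>z \<in> annulus a. cmod (F a z) \<le> M" by (auto simp: Cb_def bounded_iff)
  have "cmod (F r z) \<le> max M 1" if "a < r" "r < 1" "z \<in> annulus r" for r z
  proof -
    have "F a z = F r z" using a(2)[of a r z] that by simp
    moreover have "z \<in> annulus a" using annulus_mono[of a r] that by auto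
    ultimately show ?thesis using M by (metis max.coboundedI1)
  qed
  then have "\<forall>\<^sub>F r in at_left 1. \<forall>z \<in> annulus r. cmod (F r z) \<le> max M 1"
    using a(1) unfolding eventually_left_1 by blast
  then show ?thesis by (intro exI[of _ "max M 1"]) auto
qed

lemma null_families_mult:
  assumes F: "F \<in> families" and G: "G \<in> null_families"
  shows "(\<lambda>r z. F r z * G r z) \<in> null_families"
  unfolding null_families_iff
proof (intro conjI allI impI)
  show "(\<lambda>r z. F r z * G r z) \<in> families"
    using assms by (intro families_mult) (auto simp: null_families_def)
  fix e :: real assume e: "0 < e"
  obtain M where M: "0 < M" "\<forall>\<^sub>F r in at_left 1. \<forall>z \<in> annulus r. cmod (F r z) \<le> M"
    using families_eventually_bounded[OF F] by blast
  have "0 < e / M" using e M by simp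
  then have "\<forall>\<^sub>F r in at_left 1. \<forall>z \<in> annulus r. cmod (G r z) \<le> e / M"
    using G unfolding null_families_iff by blast
  with M(2) show "\<forall>\<^sub>F r in at_left 1. \<forall>z \<in> annulus r. cmod (F r z * G r z) \<le> e"
  proof eventually_elim
    case (elim r)
    show ?case
    proof
      fix z assume "z \<in> annulus r"
      then have "cmod (F r z) \<le> M" "cmod (G r z) \<le> e / M" using elim by auto
      then have "cmod (F r z * G r z) \<le> M * (e / M)"
        unfolding norm_mult by (intro mult_mono') auto
      then show "cmod (F r z * G r z) \<le> e" using M by simp
    qed
  qed
qed

lemma null_families_zero: "(\<lambda>_ _. 0) \<in> null_families"
  using families_const[of 0] by (auto simp: null_families_iff)

lemma null_families_uminus: "F \<in> null_families \<Longrightarrow> (\<lambda>r z. - F r z) \<in> null_families"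
  using null_families_mult[OF families_const[of "-1"], of F] by simp

lemma null_families_cnj: "F \<in> null_families \<Longrightarrow> (\<lambda>r z. cnj (F r z)) \<in> null_families"
  using families_cnj[of F] by (auto simp: null_families_iff)

lemma null_families_mult_diff:
  assumes "F \<in> families" "G' \<in> families" "(\<lambda>r z. F r z - F' r z) \<in> null_families"
    "(\<lambda>r z. G r z - G' r z) \<in> null_families"
  shows "(\<lambda>r z. F r z * G r z - F' r z * G' r z) \<in> null_families"
  using null_families_add[OF null_families_mult[OF assms(1,4)] null_families_mult[OF assms(2,3)]]
  by (simp add: algebra_simps)

lemma fam_rel_refl: "F \<in> families \<Longrightarrow> fam_rel F F"
  using null_families_zero by (simp add: fam_rel_def)

lemma fam_rel_eqI: "F \<in> families \<Longrightarrow> (\<And>r z. F r z = G r z) \<Longrightarrow> fam_rel F G"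
proof -
  assume "F \<in> families" and *: "\<And>r z. F r z = G r z"
  moreover from * have "F = G" by blast
  ultimately show "fam_rel F G" using fam_rel_refl by simp
qed

lemma fam_relD: "fam_rel F G \<Longrightarrow> F \<in> families"
  by (simp add: fam_rel_def)

quotient_type salg = "real \<Rightarrow> complex \<Rightarrow> complex" / partial: fam_rel
proof (rule part_equivpI)
  show "\<exists>F. fam_rel F F" using fam_rel_refl[OF families_const] by blast
  show "symp fam_rel"
  proof (rule sympI)
    fix F G assume "fam_rel F G"
    then show "fam_rel G F"
      using null_families_uminus[of "\<lambda>r z. F r z - G r z"] by (simp add: fam_rel_def)
  qed
  show "transp fam_rel"
  proof (rule transpI)
    fix F G H assume "fam_rel F G" "fam_rel G H"
    then show "fam_rel F H"
      using null_families_add[of "\<lambda>r z. F r z - G r z" "\<lambda>r z. G r z - H r z"]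
      by (simp add: fam_rel_def)
  qed
qed

instantiation salg :: comm_ring_1
begin

lift_definition zero_salg :: salg is "\<lambda>_ _. 0"
  by (rule fam_rel_refl[OF families_const])
lift_definition one_salg :: salg is "\<lambda>_ _. 1"
  by (rule fam_rel_refl[OF families_const])
lift_definition plus_salg :: "salg \<Rightarrow> salg \<Rightarrow> salg" is "\<lambda>F G r z. F r z + G r z"
proof -
  fix F F' G G' assume *: "fam_rel F F'" "fam_rel G G'"
  then have "(\<lambda>r z. (F r z - F' r z) + (G r z - G' r z)) \<in> null_families"
    by (intro null_families_add) (auto simp: fam_rel_def)
  with * show "fam_rel (\<lambda>r z. F r z + G r z) (\<lambda>r z. F' r z + G' r z)"
    by (simp add: fam_rel_def families_add add_diff_add)
qed
lift_definition times_salg :: "salg \<Rightarrow> salg \<Rightarrow> salg" is "\<lambda>F G r z. F r z * G r z"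
  by (auto simp: fam_rel_def intro: families_mult null_families_mult_diff)
lift_definition uminus_salg :: "salg \<Rightarrow> salg" is "\<lambda>F r z. - F r z"
proof -
  fix F F' assume "fam_rel F F'"
  then show "fam_rel (\<lambda>r z. - F r z) (\<lambda>r z. - F' r z)"
    using null_families_uminus[of "\<lambda>r z. F r z - F' r z"] by (auto simp: fam_rel_def families_uminus)
qed
definition minus_salg :: "salg \<Rightarrow> salg \<Rightarrow> salg" where "minus_salg f g = f + - g"

instance
proof
  fix a b c :: salg
  show "a * b * c = a * (b * c)"
    by transfer (rule fam_rel_eqI; (intro families_mult)?; (erule fam_relD | simp))
  show "a * b = b * a"
    by transfer (rule fam_rel_eqI; (intro families_mult)?; (erule fam_relD | simp))
  show "1 * a = a"
    by transfer simp
  show "a + b + c = a + (b + c)"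
    by transfer (rule fam_rel_eqI; (intro families_add)?; (erule fam_relD | simp))
  show "a + b = b + a"
    by transfer (rule fam_rel_eqI; (intro families_add)?; (erule fam_relD | simp))
  show "0 + a = a"
    by transfer simp
  show "- a + a = 0"
    by transfer (simp add: fam_rel_refl families_const)
  show "a - b = a + - b"
    by (rule minus_salg_def)
  show "(a + b) * c = a * c + b * c"
    by transfer (rule fam_rel_eqI; (intro families_add families_mult)?;
      (erule fam_relD | simp add: distrib_right))
  show "(0::salg) \<noteq> 1"
  proof transfer
    show "\<not> fam_rel (\<lambda>_ _. 0) (\<lambda>_ _. 1)"
    proof
      assume "fam_rel (\<lambda>_ _. 0) (\<lambda>_ _. 1)"
      then have "\<forall>\<^sub>F r in at_left 1. \<forall>z \<in> annulus r. cmod (0 - 1) \<le> 1 / 2"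
        unfolding fam_rel_def null_families_iff
        by (elim conjE allE[of _ "1/2"] impE) auto
      then obtain b :: real where b: "b \<in> {0<..<1}"
        "\<And>r. b < r \<Longrightarrow> r < 1 \<Longrightarrow> \<forall>z \<in> annulus r. cmod (0 - 1) \<le> 1 / 2"
        by (auto simp: eventually_left_1)
      from b(1) obtain r where r: "b < r" "r < 1" using dense[of b 1] by auto
      then have "annulus r \<noteq> {}" using b(1) by (intro annulus_nonempty) auto
      then obtain z where "z \<in> annulus r" by blast
      with b(2)[OF r] have "cmod (0 - 1) \<le> 1 / 2" by blast
      then show False by simp
    qed
  qed
qed

end

lift_definition star :: "salg \<Rightarrow> salg" is "\<lambda>F r z. cnj (F r z)"
proof -
  fix F F' assume "fam_rel F F'"
  then show "fam_rel (\<lambda>r z. cnj (F r z)) (\<lambda>r z. cnj (F' r z))"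
    using null_families_cnj[of "\<lambda>r z. F r z - F' r z"] by (auto simp: fam_rel_def families_cnj)
qed

text \<open>The class of the family of restrictions of a bounded continuous function on the
  punctured disc; meaningless for other functions.\<close>

definition to_S :: "(complex \<Rightarrow> complex) \<Rightarrow> salg" where
  "to_S f = abs_salg (\<lambda>r. f)"

definition hinf_to_S :: "hinf \<Rightarrow> salg" where
  "hinf_to_S f = to_S (Rep_hinf f)"


section \<open>The index\<close>

text \<open>The library's winding number is complex-valued; it is an integer for closed curves.\<close>

definition wind :: "(complex \<Rightarrow> complex) \<Rightarrow> complex" where
  "wind h = winding_number (h \<circ> circlepath 0 1) 0"

definition wind_on :: "(complex \<Rightarrow> complex) \<Rightarrow> real \<Rightarrow> complex" where
  "wind_on g \<rho> = wind (\<lambda>\<zeta>. g (of_real \<rho> * \<zeta>))"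

text \<open>The limit of an integer-valued quantity, as eventual equality; it does not depend on the
  choice of the radius \<open>\<rho> \<in> (r,1)\<close> nor of the representative when \<open>f\<close> is invertible.\<close>

definition W :: "salg \<Rightarrow> complex" where
  "W f = (THE n. \<forall>F \<in> families. abs_salg F = f \<longrightarrow>
            (\<forall>\<^sub>F r in at_left 1. \<forall>\<rho> \<in> {r<..<1}. wind_on (F r) \<rho> = n))"


section \<open>Plants\<close>

definition map_mat :: "('a \<Rightarrow> 'b) \<Rightarrow> 'a^'n^'m \<Rightarrow> 'b^'n^'m" where
  "map_mat h A = (\<chi> i j. h (A $ i $ j))"

definition star_mat :: "('a \<Rightarrow> 'a) \<Rightarrow> 'a^'n^'m \<Rightarrow> 'a^'m^'n" where
  "star_mat s A = (\<chi> i j. s (A $ j $ i))"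

definition frac_mat :: "hinf^'n^'m \<Rightarrow> hinf fract^'n^'m" where
  "frac_mat = map_mat (\<lambda>f. Fract f 1)"

definition S_mat :: "hinf^'n^'m \<Rightarrow> salg^'n^'m" where
  "S_mat = map_mat hinf_to_S"

definition eval_mat :: "hinf^'n^'m \<Rightarrow> complex \<Rightarrow> complex^'n^'m" where
  "eval_mat A z = map_mat (\<lambda>f. Rep_hinf f z) A"

definition normalized_rcf ::
    "hinf fract^'m^'p \<Rightarrow> hinf^'m^'p \<Rightarrow> hinf^'m^'m \<Rightarrow> bool" where
  "normalized_rcf P N D \<longleftrightarrow>
     invertible (frac_mat D) \<and> P = frac_mat N ** matrix_inv (frac_mat D) \<and>
     (\<exists>(X :: hinf^'p^'m) (Y :: hinf^'m^'m). X ** N + Y ** D = mat 1) \<and>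
     star_mat star (S_mat N) ** S_mat N + star_mat star (S_mat D) ** S_mat D = mat 1"

definition normalized_lcf ::
    "hinf fract^'m^'p \<Rightarrow> hinf^'p^'p \<Rightarrow> hinf^'m^'p \<Rightarrow> bool" where
  "normalized_lcf P D N \<longleftrightarrow>
     invertible (frac_mat D) \<and> P = matrix_inv (frac_mat D) ** frac_mat N \<and>
     (\<exists>(X :: hinf^'p^'m) (Y :: hinf^'p^'p). N ** X + D ** Y = mat 1) \<and>
     S_mat N ** star_mat star (S_mat N) + S_mat D ** star_mat star (S_mat D) = mat 1"

text \<open>The dimensions \<open>p\<close> and \<open>m\<close> are the cardinalities of the index types.\<close>

definition plants :: "(hinf fract^'m^'p) set" where
  "plants = {P. (\<exists>N D. normalized_rcf P N D) \<and> (\<exists>D N. normalized_lcf P D N)}"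


section \<open>The two metrics\<close>

definition G_mat :: "hinf^'m^'p \<Rightarrow> hinf^'m^'m \<Rightarrow> hinf^'m^('p + 'm)" where
  "G_mat N D = (\<chi> i. case i of Inl a \<Rightarrow> N $ a | Inr b \<Rightarrow> D $ b)"

definition Gt_mat :: "hinf^'p^'p \<Rightarrow> hinf^'m^'p \<Rightarrow> hinf^('p + 'm)^'p" where
  "Gt_mat D N = (\<chi> i j. case j of Inl a \<Rightarrow> - (D $ i $ a) | Inr b \<Rightarrow> N $ i $ b)"

definition hinf_norm :: "hinf^'n^'m \<Rightarrow> real" where
  "hinf_norm F = (SUP z \<in> ball 0 1. onorm (\<lambda>x. eval_mat F z *v x))"

definition det_fun :: "hinf^'m^'n \<Rightarrow> hinf^'m^'n \<Rightarrow> complex \<Rightarrow> complex" where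
  "det_fun G1 G2 z = det (star_mat cnj (eval_mat G1 z) ** eval_mat G2 z)"

text \<open>The metrics are given in terms of the matrices \<open>G\<^sub>1\<close>, \<open>G\<^sub>2\<close> and \<open>Gt\<^sub>2 = [-Dt\<^sub>2, Nt\<^sub>2]\<close> of the chosen
  normalized coprime factorizations of the two plants. In the commutative ring \<open>salg\<close>,
  \<open>s dvd 1\<close> says that \<open>s\<close> is invertible.\<close>

definition d_nu :: "hinf^'m^('p + 'm) \<Rightarrow> hinf^'m^('p + 'm) \<Rightarrow> hinf^('p + 'm)^'p \<Rightarrow> real" where
  "d_nu G1 G2 Gt2 =
     (if to_S (det_fun G1 G2) dvd 1 \<and> W (to_S (det_fun G1 G2)) = 0
      then hinf_norm (Gt2 ** G1) else 1)"

definition d_nu_tilde_at ::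
    "real \<Rightarrow> hinf^'m^('p + 'm) \<Rightarrow> hinf^'m^('p + 'm) \<Rightarrow> hinf^('p + 'm)^'p \<Rightarrow> real" where
  "d_nu_tilde_at \<rho> G1 G2 Gt2 =
     (if det_fun G1 G2 \<in> Cb_inv \<rho> \<and> (\<forall>r \<in> {\<rho><..<1}. wind_on (det_fun G1 G2) r = 0)
      then hinf_norm (Gt2 ** G1) else 1)"

definition d_nu_tilde :: "hinf^'m^('p + 'm) \<Rightarrow> hinf^'m^('p + 'm) \<Rightarrow> hinf^('p + 'm)^'p \<Rightarrow> real" where
  "d_nu_tilde G1 G2 Gt2 = Lim (at_left 1) (\<lambda>\<rho>. d_nu_tilde_at \<rho> G1 G2 Gt2)"

lemma Cb_mono: "f \<in> Cb r \<Longrightarrow> r \<le> R \<Longrightarrow> f \<in> Cb R"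
  using annulus_mono[of r R] unfolding Cb_def
  by (auto intro: continuous_on_subset bounded_subset[OF _ image_mono])

lemma Cb_inv_mono: "f \<in> Cb_inv r \<Longrightarrow> r \<le> R \<Longrightarrow> f \<in> Cb_inv R"
  unfolding Cb_inv_def using annulus_mono[of r R] Cb_mono[of _ r R] by blast

lemma eventually_const_if:
  fixes P :: "real \<Rightarrow> bool"
  assumes mono: "\<And>r R. P r \<Longrightarrow> r \<le> R \<Longrightarrow> P R"
  shows "\<exists>c. \<forall>\<^sub>F \<rho> in at_left 1. (if P \<rho> then a else b) = c"
proof (cases "\<exists>\<rho> < 1. P \<rho>")
  case True
  then obtain r where "r < 1" "P r" by blast
  then have "\<forall>\<^sub>F \<rho> in at_left 1. (if P \<rho> then a else b) = a"
    unfolding eventually_at_left_field using mono by (intro exI[of _ r]) auto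
  then show ?thesis by blast
next
  case False
  then have "\<forall>\<^sub>F \<rho> in at_left 1. (if P \<rho> then a else b) = b"
    unfolding eventually_at_left_field by (intro exI[of _ 0]) auto
  then show ?thesis by blast
qed

text \<open>The limit defining \<open>d_nu_tilde\<close> exists: its argument is eventually constant.\<close>

lemma d_nu_tilde_tendsto:
  "((\<lambda>\<rho>. d_nu_tilde_at \<rho> G1 G2 Gt2) \<longlongrightarrow> d_nu_tilde G1 G2 Gt2) (at_left 1)"
proof -
  have "\<exists>c. \<forall>\<^sub>F \<rho> in at_left 1. d_nu_tilde_at \<rho> G1 G2 Gt2 = c"
    unfolding d_nu_tilde_at_def
  proof (rule eventually_const_if, elim conjE, intro conjI)
    fix r R :: real
    assume r: "r \<le> R"
    show "det_fun G1 G2 \<in> Cb_inv R" if "det_fun G1 G2 \<in> Cb_inv r"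
      using that r by (rule Cb_inv_mono)
    show "\<forall>s \<in> {R<..<1}. wind_on (det_fun G1 G2) s = 0"
      if "\<forall>s \<in> {r<..<1}. wind_on (det_fun G1 G2) s = 0"
    proof
      fix s assume "s \<in> {R<..<1}"
      then have "s \<in> {r<..<1}" using r by simp
      with that show "wind_on (det_fun G1 G2) s = 0" by (rule bspec)
    qed
  qed
  then obtain c where "\<forall>\<^sub>F \<rho> in at_left 1. d_nu_tilde_at \<rho> G1 G2 Gt2 = c" ..
  then have "((\<lambda>\<rho>. d_nu_tilde_at \<rho> G1 G2 Gt2) \<longlongrightarrow> c) (at_left 1)"
    by (rule tendsto_eventually)
  moreover from this have "d_nu_tilde G1 G2 Gt2 = c"
    unfolding d_nu_tilde_def by (intro tendsto_Lim) simp_all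
  ultimately show ?thesis by (simp only:)
qed

end

theory Submission
  imports Defs
begin

text \<open>Both metrics return \<open>hinf_norm (Gt2 ** G1)\<close> or \<open>1\<close>, so only the conditions choosing between the
  two values have to be compared. Write \<open>f\<close> for \<open>det_fun G1 G2\<close>, which is continuous and bounded on
  the whole disc (\<open>det_fun_in_Cb\<close>).

  An inverse of \<open>f\<close> in the limit algebra inverts \<open>f\<close> only up to a small error near the unit circle.
  Since representatives are bounded, this already keeps \<open>f\<close> away from \<open>0\<close> on a thin annulus, and then
  \<open>1/f\<close> is an exact inverse there; hence \<open>f\<close> is invertible in the limit algebra if and only if it
  is invertible on some annulus (\<open>to_S_dvd_1_iff\<close>).

  On such an annulus the winding number of \<open>f\<close> along circles does not depend on the radius, by
  homotopy invariance, and it does not change under perturbations smaller than the lower bound of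
  \<open>\<bar>f\<bar>\<close>. So all representatives of the class of \<open>f\<close> eventually have the same winding number as \<open>f\<close>,
  and \<open>W\<close> of the class is the winding number of \<open>f\<close> on any one circle of the annulus
  (\<open>W_to_S\<close>).

  Therefore the condition in \<open>d_nu\<close> says that the condition in \<open>d_nu_tilde_at\<close> holds for some
  radius in \<open>(0,1)\<close>. The latter condition is inherited by larger radii, so \<open>d_nu_tilde\<close> is
  decided by the same existential statement (\<open>d_nu_tilde_eventual_value\<close>).\<close>

section \<open>Equality and invertibility in the limit algebra\<close>

lemma abs_salg_eq_iff:
  assumes "F \<in> families" "G \<in> families"
  shows "abs_salg F = abs_salg G \<longleftrightarrow> (\<lambda>r z. F r z - G r z) \<in> null_families"
  using Quotient_rel[OF Quotient_salg, of F G] fam_rel_refl assms by (auto simp: fam_rel_def)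

lemma salg_representative:
  obtains F where "F \<in> families" "s = abs_salg F"
  using that Quotient_rep_reflp[OF Quotient_salg, of s] Quotient_abs_rep[OF Quotient_salg, of s]
  by (auto simp: fam_rel_def)

lemma constant_family: "\<forall>r \<in> {0<..<1}. f \<in> Cb r \<Longrightarrow> (\<lambda>r. f) \<in> families"
  unfolding families_def using dense[of 0 "1::real"] by auto

lemma families_bounded:
  assumes "F \<in> families" "r \<in> {0<..<1}"
  obtains M where "M > 0" "\<And>z. z \<in> annulus r \<Longrightarrow> cmod (F r z) \<le> M"
proof -
  have "bounded (F r ` annulus r)" using assms by (auto simp: families_def Cb_def)
  then show ?thesis using that unfolding bounded_pos by auto
qed

lemma Cb_inv_iff_bounded_below:
  assumes f: "f \<in> Cb r"
  shows "f \<in> Cb_inv r \<longleftrightarrow> (\<exists>d>0. \<forall>z \<in> annulus r. d \<le> cmod (f z))"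
proof
  assume "f \<in> Cb_inv r"
  then obtain g where g: "g \<in> Cb r" "\<And>z. z \<in> annulus r \<Longrightarrow> f z * g z = 1"
    by (auto simp: Cb_inv_def)
  from g(1) obtain M where M: "M > 0" "\<And>z. z \<in> annulus r \<Longrightarrow> cmod (g z) \<le> M"
    unfolding Cb_def bounded_pos by auto
  have "1 / M \<le> cmod (f z)" if z: "z \<in> annulus r" for z
  proof -
    have "1 = cmod (f z) * cmod (g z)" using g(2)[OF z] by (metis norm_mult norm_one)
    also have "\<dots> \<le> cmod (f z) * M" using M(2)[OF z] by (intro mult_left_mono) auto
    finally show ?thesis using M(1) by (simp add: field_simps)
  qed
  then show "\<exists>d>0. \<forall>z \<in> annulus r. d \<le> cmod (f z)"
    using M(1) by (intro exI[of _ "1 / M"]) auto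
next
  assume "\<exists>d>0. \<forall>z \<in> annulus r. d \<le> cmod (f z)"
  then obtain d where d: "d > 0" "\<And>z. z \<in> annulus r \<Longrightarrow> d \<le> cmod (f z)" by blast
  have nz: "f z \<noteq> 0" if "z \<in> annulus r" for z using d(1) d(2)[OF that] by auto
  have "cmod (inverse (f z)) \<le> inverse d" if "z \<in> annulus r" for z
    using d(1) d(2)[OF that] by (simp add: norm_inverse le_imp_inverse_le)
  then have "(\<lambda>z. inverse (f z)) \<in> Cb r"
    using f nz by (auto simp: Cb_def bounded_iff intro!: continuous_on_inverse)
  then show "f \<in> Cb_inv r" using f nz unfolding Cb_inv_def by (auto intro!: bexI)
qed

text \<open>If \<open>\<bar>f F - 1\<bar> \<le> 1/2\<close> and \<open>\<bar>F\<bar> \<le> M\<close> on an annulus, then \<open>\<bar>f\<bar> \<ge> 1/(2M)\<close> there, so an inverse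
  modulo null families can be replaced by the pointwise one.\<close>

lemma to_S_dvd_1_iff:
  assumes f: "\<forall>r \<in> {0<..<1}. f \<in> Cb r"
  shows "to_S f dvd 1 \<longleftrightarrow> (\<exists>r \<in> {0<..<1}. f \<in> Cb_inv r)"
proof -
  have ff: "(\<lambda>r. f) \<in> families" using f by (rule constant_family)
  have one: "(\<lambda>_ _. 1) \<in> families" by (rule families_const)
  have mult: "to_S f * abs_salg F = 1 \<longleftrightarrow> (\<lambda>r z. f z * F r z - 1) \<in> null_families"
    if F: "F \<in> families" for F
    using abs_salg_eq_iff[OF families_mult[OF ff F] one]
    by (simp add: to_S_def one_salg_def times_salg.abs_eq fam_rel_refl ff F)
  show ?thesis
  proof
    assume "to_S f dvd 1"
    then obtain k where k: "1 = to_S f * k" by (elim dvdE)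
    obtain F where F: "F \<in> families" "k = abs_salg F" by (rule salg_representative)
    have "(\<lambda>r z. f z * F r z - 1) \<in> null_families" using mult F k by simp
    then have "\<forall>\<^sub>F r in at_left 1. \<forall>z \<in> annulus r. cmod (f z * F r z - 1) \<le> 1/2"
      unfolding null_families_iff by (elim conjE allE[of _ "1/2"] impE) auto
    then obtain b where b: "b \<in> {0<..<1}"
      "\<And>r z. b < r \<Longrightarrow> r < 1 \<Longrightarrow> z \<in> annulus r \<Longrightarrow> cmod (f z * F r z - 1) \<le> 1/2"
      unfolding eventually_left_1 by blast
    obtain r where r: "b < r" "r < 1" using dense[of b 1] b(1) by auto
    then have r01: "r \<in> {0<..<1}" using b(1) by auto
    obtain M where M: "M > 0" "\<And>z. z \<in> annulus r \<Longrightarrow> cmod (F r z) \<le> M"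
      using families_bounded[OF F(1) r01] by blast
    have "1 / (2 * M) \<le> cmod (f z)" if z: "z \<in> annulus r" for z
    proof -
      have "1/2 \<le> cmod (f z * F r z)"
        using b(2)[OF r z] norm_triangle_ineq2[of 1 "f z * F r z"]
        by (simp add: norm_minus_commute)
      also have "\<dots> \<le> cmod (f z) * M"
        unfolding norm_mult using M(2)[OF z] by (intro mult_left_mono) auto
      finally show ?thesis using M(1) by (simp add: field_simps)
    qed
    then have "f \<in> Cb_inv r"
      unfolding Cb_inv_iff_bounded_below[OF bspec[OF f r01]] using M(1)
      by (intro exI[of _ "1 / (2 * M)"]) auto
    then show "\<exists>r \<in> {0<..<1}. f \<in> Cb_inv r" using r01 by blast
  next
    assume "\<exists>r \<in> {0<..<1}. f \<in> Cb_inv r"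
    then obtain a g where a: "a \<in> {0<..<1}" and g: "g \<in> Cb a" "\<And>z. z \<in> annulus a \<Longrightarrow> f z * g z = 1"
      by (auto simp: Cb_inv_def)
    \<comment> \<open>The inverse is only known on \<open>annulus a\<close>; below \<open>a\<close> the family takes an
      arbitrary value, since classes depend only on radii near \<open>1\<close>.\<close>
    define F where "F r z = (if a \<le> r then g z else 0)" for r z
    have "F r \<in> Cb r" for r
      using Cb_mono[OF g(1), of r] by (cases "a \<le> r") (auto simp: F_def Cb_def bounded_iff)
    then have F: "F \<in> families"
      using a unfolding families_def by (auto simp: F_def intro!: bexI[of _ a])
    have "\<forall>z \<in> annulus r. cmod (f z * F r z - 1) \<le> e" if "a < r" "0 < e" for r e :: real
      using that annulus_mono[of a r] g(2) by (auto simp: F_def)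
    then have "(\<lambda>r z. f z * F r z - 1) \<in> null_families"
      using families_diff[OF families_mult[OF ff F] one] a
      unfolding null_families_iff eventually_left_1 by blast
    then have "to_S f * abs_salg F = 1" using mult[OF F] by simp
    then show "to_S f dvd 1" by (metis dvdI)
  qed
qed

section \<open>Stability of the winding number\<close>

lemma wind_on_eq: "wind_on f \<rho> = winding_number (f \<circ> circlepath 0 \<rho>) 0"
proof -
  have "(\<lambda>\<zeta>. f (of_real \<rho> * \<zeta>)) \<circ> circlepath 0 1 = f \<circ> circlepath 0 \<rho>"
    by (auto simp: circlepath)
  then show ?thesis by (simp add: wind_on_def wind_def)
qed

lemma circlepath_in_annulus:
  "r < \<rho> \<Longrightarrow> \<rho> < 1 \<Longrightarrow> 0 < \<rho> \<Longrightarrow> path_image (circlepath 0 \<rho>) \<subseteq> annulus r"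
  by (auto simp: annulus_def)

lemma circle_segment_in_annulus:
  assumes "r \<in> {0<..<1}" "a \<in> {r<..<1}" "b \<in> {r<..<1}"
  shows "closed_segment (circlepath 0 a t) (circlepath 0 b t) \<subseteq> annulus r"
proof
  fix x assume "x \<in> closed_segment (circlepath 0 a t) (circlepath 0 b t)"
  then obtain u where u: "0 \<le> u" "u \<le> 1"
    "x = (1 - u) *\<^sub>R circlepath 0 a t + u *\<^sub>R circlepath 0 b t"
    unfolding closed_segment_def by blast
  define c where "c = (1 - u) * a + u * b"
  have x: "x = of_real c * exp (2 * of_real pi * \<i> * of_real t)"
    by (simp add: u(3) c_def circlepath scaleR_conv_of_real algebra_simps)
  have "c \<in> {r<..<1}"
    using convexD[OF convex_real_interval(8), of a r 1 b "1 - u" u] assms u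
    by (simp add: c_def)
  moreover have "cmod x = \<bar>c\<bar>" by (simp add: x norm_mult norm_exp_eq_Re)
  ultimately show "x \<in> annulus r" using assms(1) by (simp add: annulus_def)
qed

text \<open>Concentric circles are homotopic in the annulus along radial segments, and \<open>f\<close> carries this
  homotopy into the punctured plane.\<close>

lemma wind_on_radius_independent:
  assumes r: "r \<in> {0<..<1}" and f: "f \<in> Cb_inv r" and ab: "a \<in> {r<..<1}" "b \<in> {r<..<1}"
  shows "wind_on f a = wind_on f b"
  unfolding wind_on_eq
proof (rule winding_number_homotopic_loops)
  have "homotopic_loops (annulus r) (circlepath 0 a) (circlepath 0 b)"
    using circle_segment_in_annulus[OF r ab] by (intro homotopic_loops_linear) auto
  moreover have "continuous_on (annulus r) f" using f by (auto simp: Cb_inv_def Cb_def)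
  moreover have "f \<in> annulus r \<rightarrow> - {0}" using f by (auto simp: Cb_inv_def)
  ultimately show "homotopic_loops (- {0}) (f \<circ> circlepath 0 a) (f \<circ> circlepath 0 b)"
    by (rule homotopic_loops_continuous_image)
qed

text \<open>The dog-on-a-leash principle, by which the winding number will depend only on the class in the
  limit algebra.\<close>

lemma wind_on_dominated_perturbation:
  assumes r: "r \<in> {0<..<1}" and f: "f \<in> Cb r" and g: "g \<in> Cb r" and \<rho>: "\<rho> \<in> {r<..<1}"
    and close: "\<And>z. z \<in> annulus r \<Longrightarrow> cmod (g z - f z) < cmod (f z)"
  shows "wind_on g \<rho> = wind_on f \<rho>"
  unfolding wind_on_eq
proof (rule winding_number_nearby_loops_eq)
  have circ: "path_image (circlepath 0 \<rho>) \<subseteq> annulus r"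
    using r \<rho> by (intro circlepath_in_annulus) auto
  then have cont: "continuous_on (path_image (circlepath 0 \<rho>)) f"
     "continuous_on (path_image (circlepath 0 \<rho>)) g"
    using f g by (auto simp: Cb_def intro: continuous_on_subset)
  show "path (f \<circ> circlepath 0 \<rho>)" "path (g \<circ> circlepath 0 \<rho>)"
    using cont by (auto intro!: path_continuous_image)
  show "pathfinish (f \<circ> circlepath 0 \<rho>) = pathstart (f \<circ> circlepath 0 \<rho>)"
    "pathfinish (g \<circ> circlepath 0 \<rho>) = pathstart (g \<circ> circlepath 0 \<rho>)"
    by (simp_all add: pathfinish_compose pathstart_compose)
  show "cmod ((g \<circ> circlepath 0 \<rho>) t - (f \<circ> circlepath 0 \<rho>) t) < cmod ((f \<circ> circlepath 0 \<rho>) t - 0)"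
    if "t \<in> {0..1}" for t
    using close[of "circlepath 0 \<rho> t"] circ that by (force simp: path_image_def)
qed

text \<open>Uniqueness in the definition of \<open>W\<close> comes from the constant family of \<open>f\<close> itself. Existence
  holds because any other representative is eventually within half the lower bound of \<open>\<bar>f\<bar>\<close>.\<close>

lemma W_to_S:
  assumes f: "\<forall>r \<in> {0<..<1}. f \<in> Cb r"
    and r: "r \<in> {0<..<1}" and inv: "f \<in> Cb_inv r" and \<rho>: "\<rho> \<in> {r<..<1}"
  shows "W (to_S f) = wind_on f \<rho>"
  unfolding W_def
proof (rule the_equality)
  have ff: "(\<lambda>r. f) \<in> families" using f by (rule constant_family)
  show "\<forall>F \<in> families. abs_salg F = to_S f \<longrightarrow>
    (\<forall>\<^sub>F r in at_left 1. \<forall>\<sigma> \<in> {r<..<1}. wind_on (F r) \<sigma> = wind_on f \<rho>)"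
  proof (intro ballI impI)
    fix F assume F: "F \<in> families" and eq: "abs_salg F = to_S f"
    from inv obtain d where d: "d > 0" "\<And>z. z \<in> annulus r \<Longrightarrow> d \<le> cmod (f z)"
      unfolding Cb_inv_iff_bounded_below[OF bspec[OF f r]] by blast
    have "(\<lambda>r z. F r z - f z) \<in> null_families"
      using eq abs_salg_eq_iff[OF F ff] by (simp add: to_S_def)
    then have "\<forall>\<^sub>F s in at_left 1. \<forall>z \<in> annulus s. cmod (F s z - f z) \<le> d / 2"
      unfolding null_families_iff using d(1) by (elim conjE allE[of _ "d/2"] impE) auto
    moreover have "\<forall>\<^sub>F s in at_left 1. r < s \<and> s < 1"
      using r unfolding eventually_left_1 by blast
    ultimately show "\<forall>\<^sub>F s in at_left 1. \<forall>\<sigma> \<in> {s<..<1}. wind_on (F s) \<sigma> = wind_on f \<rho>"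
    proof eventually_elim
      case (elim s)
      show ?case
      proof
        fix \<sigma> assume \<sigma>: "\<sigma> \<in> {s<..<1}"
        have s: "s \<in> {0<..<1}" using r elim by auto
        have "cmod (F s z - f z) < cmod (f z)" if z: "z \<in> annulus s" for z
        proof -
          have "cmod (F s z - f z) \<le> d / 2" using elim z by blast
          moreover have "d \<le> cmod (f z)" using d(2) annulus_mono[of r s] elim z by auto
          ultimately show ?thesis using d(1) by linarith
        qed
        moreover have "F s \<in> Cb s" using F s by (auto simp: families_def)
        ultimately have "wind_on (F s) \<sigma> = wind_on f \<sigma>"
          using wind_on_dominated_perturbation[OF s bspec[OF f s] _ \<sigma>] by blast
        also have "\<dots> = wind_on f \<rho>"
          using wind_on_radius_independent[OF r inv _ \<rho>] \<sigma> elim by auto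
        finally show "wind_on (F s) \<sigma> = wind_on f \<rho>" .
      qed
    qed
  qed
  fix n assume "\<forall>F \<in> families. abs_salg F = to_S f \<longrightarrow>
    (\<forall>\<^sub>F r in at_left 1. \<forall>\<sigma> \<in> {r<..<1}. wind_on (F r) \<sigma> = n)"
  then have "\<forall>\<^sub>F r in at_left 1. \<forall>\<sigma> \<in> {r<..<1}. wind_on f \<sigma> = n"
    using ff by (auto simp: to_S_def)
  then obtain b where b: "b \<in> {0<..<1}"
    "\<And>s \<sigma>. b < s \<Longrightarrow> s < 1 \<Longrightarrow> \<sigma> \<in> {s<..<1} \<Longrightarrow> wind_on f \<sigma> = n"
    unfolding eventually_left_1 by blast
  obtain s where s: "max b r < s" "s < 1" using dense[of "max b r" 1] b(1) r by auto
  obtain \<sigma> where \<sigma>: "s < \<sigma>" "\<sigma> < 1" using dense[of s 1] s(2) by auto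
  have "n = wind_on f \<sigma>" using b(2)[of s \<sigma>] s \<sigma> by simp
  also have "\<dots> = wind_on f \<rho>"
    using wind_on_radius_independent[OF r inv _ \<rho>] s \<sigma> by auto
  finally show "n = wind_on f \<rho>" .
qed

lemma S_index_condition_iff_annulus_condition:
  assumes f: "\<forall>r \<in> {0<..<1}. f \<in> Cb r"
  shows "to_S f dvd 1 \<and> W (to_S f) = 0 \<longleftrightarrow>
    (\<exists>r \<in> {0<..<1}. f \<in> Cb_inv r \<and> (\<forall>\<rho> \<in> {r<..<1}. wind_on f \<rho> = 0))"
proof -
  have "W (to_S f) = 0 \<longleftrightarrow> (\<forall>\<rho> \<in> {r<..<1}. wind_on f \<rho> = 0)"
    if r: "r \<in> {0<..<1}" "f \<in> Cb_inv r" for r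
    using W_to_S[OF f r] dense[of r 1] r(1) by force
  then show ?thesis unfolding to_S_dvd_1_iff[OF f] by blast
qed

section \<open>Determinants of bounded holomorphic matrices\<close>

lemma Cb_const: "(\<lambda>_. c) \<in> Cb r"
  by (auto simp: Cb_def bounded_iff)

lemma Cb_sum: "(\<And>i. i \<in> I \<Longrightarrow> f i \<in> Cb r) \<Longrightarrow> (\<lambda>z. \<Sum>i\<in>I. f i z) \<in> Cb r"
  by (induction I rule: infinite_finite_induct) (auto intro: Cb_const Cb_add)

lemma Cb_prod: "(\<And>i. i \<in> I \<Longrightarrow> f i \<in> Cb r) \<Longrightarrow> (\<lambda>z. \<Prod>i\<in>I. f i z) \<in> Cb r"
  by (induction I rule: infinite_finite_induct) (auto intro: Cb_const Cb_mult)

lemma Rep_hinf_in_Cb: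
  assumes "0 \<le> r"
  shows "Rep_hinf h \<in> Cb r"
proof -
  have sub: "annulus r \<subseteq> ball 0 1" by (auto simp: annulus_def)
  have "Rep_hinf h holomorphic_on ball 0 1" "bounded (Rep_hinf h ` ball 0 1)"
    using Rep_hinf[of h] by auto
  then show ?thesis
    using sub unfolding Cb_def
    by (auto intro: continuous_on_subset holomorphic_on_imp_continuous_on
        bounded_subset[OF _ image_mono])
qed

text \<open>The determinant is a polynomial in the entries and their conjugates, and \<open>Cb r\<close> is a
  \<open>*\<close>-algebra.\<close>

lemma det_fun_in_Cb:
  assumes "0 \<le> r"
  shows "det_fun G1 G2 \<in> Cb r"
proof -
  have "(\<lambda>z. det (star_mat cnj (eval_mat G1 z) ** eval_mat G2 z)) \<in> Cb r"
    unfolding det_def matrix_matrix_mult_def star_mat_def eval_mat_def map_mat_def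
    by (auto intro!: Cb_sum Cb_mult Cb_prod Cb_const Cb_cnj Rep_hinf_in_Cb assms)
  then show ?thesis by (simp add: det_fun_def[abs_def])
qed

section \<open>Equality of the two metrics\<close>

text \<open>Passing to a larger radius preserves the condition in \<open>d_nu_tilde_at\<close>, so either it holds for
  all radii near \<open>1\<close> or it fails for every radius in \<open>(0,1)\<close>.\<close>

lemma d_nu_tilde_eventual_value:
  "d_nu_tilde G1 G2 Gt2 =
     (if \<exists>r \<in> {0<..<1}. det_fun G1 G2 \<in> Cb_inv r \<and>
           (\<forall>\<rho> \<in> {r<..<1}. wind_on (det_fun G1 G2) \<rho> = 0)
      then hinf_norm (Gt2 ** G1) else 1)" (is "_ = (if ?E then _ else _)")
proof -
  have "\<forall>\<^sub>F r in at_left 1. d_nu_tilde_at r G1 G2 Gt2 = (if ?E then hinf_norm (Gt2 ** G1) else 1)"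
  proof (cases ?E)
    case True
    then obtain a where a: "a \<in> {0<..<1}" "det_fun G1 G2 \<in> Cb_inv a"
      "\<And>\<rho>. \<rho> \<in> {a<..<1} \<Longrightarrow> wind_on (det_fun G1 G2) \<rho> = 0" by blast
    have "d_nu_tilde_at r G1 G2 Gt2 = hinf_norm (Gt2 ** G1)" if "a < r" for r
      using a(3) Cb_inv_mono[OF a(2), of r] that by (auto simp: d_nu_tilde_at_def)
    with True a(1) show ?thesis unfolding eventually_left_1 if_P[OF True] by blast
  next
    case False
    then have "d_nu_tilde_at r G1 G2 Gt2 = 1" if "0 < r" "r < 1" for r
      using that by (auto simp: d_nu_tilde_at_def)
    then show ?thesis
      unfolding if_not_P[OF False] eventually_left_1 using dense[of 0 "1::real"] by auto
  qed
  then have "((\<lambda>r. d_nu_tilde_at r G1 G2 Gt2) \<longlongrightarrow>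
      (if ?E then hinf_norm (Gt2 ** G1) else 1)) (at_left 1)"
    by (rule tendsto_eventually)
  then show ?thesis by (rule tendsto_unique[OF trivial_limit_at_left_real d_nu_tilde_tendsto])
qed

theorem theorem5p2:
  fixes P1 P2 :: "hinf fract^'m^'p"
    and N1 N2 Nt1 Nt2 :: "hinf^'m^'p"
    and D1 D2 :: "hinf^'m^'m"
    and Dt1 Dt2 :: "hinf^'p^'p"
  assumes "P1 \<in> plants" and "P2 \<in> plants"
    and "normalized_rcf P1 N1 D1" and "normalized_lcf P1 Dt1 Nt1"
    and "normalized_rcf P2 N2 D2" and "normalized_lcf P2 Dt2 Nt2"
  shows "d_nu (G_mat N1 D1) (G_mat N2 D2) (Gt_mat Dt2 Nt2) =
         d_nu_tilde (G_mat N1 D1) (G_mat N2 D2) (Gt_mat Dt2 Nt2)"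
  unfolding d_nu_def d_nu_tilde_eventual_value
  by (subst S_index_condition_iff_annulus_condition) (auto intro: det_fun_in_Cb)

end
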